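(* Let $m,s$ be integers with $0\le s<m$. Define \[ R_1(x;m,s)=L_{2s+1}(x)L_{2s+3}(x)\cdots L_{2m+1}(x),\qquad R_2(x;m,s)=\sum_{k=s}^{m}\frac{1+2k}{1+2s}\binom{2m+1}{m-k}\binom{k+s}{2s}\frac{1}{L_{2k+1}(x)}, \] and $R(x;m,s)=R_1(x;m,s)R_2(x;m,s)$. Then $(x^2+4)^{m-s}$ divides $R(x;m,s)$, and the quotient $R(x;m,s)/(x^2+4)^{m-s}$ is a polynomial with integer coefficients.
   Context: The Lucas polynomials are $L_n(x)=\alpha(x)^n+\beta(x)^n$ where $\alpha(x)=\frac{x+\sqrt{x^2+4}}{2}$, $\beta(x)=\frac{x-\sqrt{x^2+4}}{2}$; equivalently $L_0(x)=2$, $L_1(x)=x$, $L_n(x)=xL_{n-1}(x)+L_{n-2}(x)$ for all integers $n$. *)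

theory Defs
  imports Complex_Main "HOL-Computational_Algebra.Polynomial_Factorial"
begin

text \<open>
  The Lucas polynomials over \<open>\<rat>\<close>. Only indices \<open>n \<ge> 0\<close> are covered; all indices
  \<open>2k + 1\<close> used below are positive. The lemma \<open>lucas_poly_Binet\<close> identifies the
  polynomials with \<open>\<alpha>(x) ^ n + \<beta>(x) ^ n\<close>.
\<close>

fun lucas_poly :: "nat \<Rightarrow> rat poly" where
  "lucas_poly 0 = [:2:]"
| "lucas_poly (Suc 0) = [:0, 1:]"
| "lucas_poly (Suc (Suc n)) = [:0, 1:] * lucas_poly (Suc n) + lucas_poly n"

lemma lucas_poly_Binet:
  fixes x :: real
  shows "poly (map_poly of_rat (lucas_poly n)) x =
           ((x + sqrt (x\<^sup>2 + 4)) / 2) ^ n + ((x - sqrt (x\<^sup>2 + 4)) / 2) ^ n"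
proof -
  define a where "a = (x + sqrt (x\<^sup>2 + 4)) / 2"
  define b where "b = (x - sqrt (x\<^sup>2 + 4)) / 2"
  have s: "sqrt (x\<^sup>2 + 4) * sqrt (x\<^sup>2 + 4) = x\<^sup>2 + 4"
    by simp
  have a: "a * a = x * a + 1"
    using s by (simp add: a_def field_simps power2_eq_square)
  have b: "b * b = x * b + 1"
    using s by (simp add: b_def field_simps power2_eq_square)
  have "poly (map_poly of_rat (lucas_poly n)) x = a ^ n + b ^ n"
  proof (induction n rule: lucas_poly.induct)
    case 1
    show ?case by (simp add: map_poly_pCons)
  next
    case 2
    show ?case by (simp add: map_poly_pCons a_def b_def field_simps)
  next
    case (3 n)
    have hom: "map_poly of_rat (p + q) = (map_poly of_rat p + map_poly of_rat q :: real poly)"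
      for p q :: "rat poly"
      by (rule poly_eqI) (simp add: coeff_map_poly of_rat_add)
    have "poly (map_poly of_rat (lucas_poly (Suc (Suc n)))) x
        = x * (a ^ Suc n + b ^ Suc n) + (a ^ n + b ^ n)"
      using 3 by (simp add: hom map_poly_pCons)
    also have "\<dots> = a ^ n * (x * a + 1) + b ^ n * (x * b + 1)"
      by (simp add: algebra_simps)
    also have "\<dots> = a ^ Suc (Suc n) + b ^ Suc (Suc n)"
      unfolding a[symmetric] b[symmetric] by (simp add: algebra_simps)
    finally show ?case .
  qed
  then show ?thesis by (simp add: a_def b_def)
qed

text \<open>
  \<open>R2\<close> is a rational function, so it and \<open>R\<close> live in the field \<open>\<rat>(x)\<close>, here
  \<^typ>\<open>rat poly fract\<close>; \<open>/\<close> is division in that field, and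
  \<open>to_fract\<close> is the embedding of \<open>\<rat>[x]\<close>.
\<close>

definition R1 :: "nat \<Rightarrow> nat \<Rightarrow> rat poly" where
  "R1 m s = (\<Prod>k=s..m. lucas_poly (2 * k + 1))"

definition R2 :: "nat \<Rightarrow> nat \<Rightarrow> rat poly fract" where
  "R2 m s = (\<Sum>k=s..m. of_nat (1 + 2 * k) / of_nat (1 + 2 * s)
       * of_nat ((2 * m + 1) choose (m - k)) * of_nat ((k + s) choose (2 * s))
       * (1 / to_fract (lucas_poly (2 * k + 1))))"

definition R :: "nat \<Rightarrow> nat \<Rightarrow> rat poly fract" where
  "R m s = to_fract (R1 m s) * R2 m s"

end

theory Submission
  imports Defs "HOL-Computational_Algebra.Field_as_Ring"
begin

text \<open>
  Put \<open>z = x^2 + 4\<close>. Then \<open>L_{2k+1}(x) = (-1)^k x W_k(z)\<close> with \<open>W_k(z) = \<Sum>j. (-1)^j (k + j choose 2j) z^j\<close>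
  (with \<open>x = 2i cos w\<close>, \<open>W_k\<close> is \<open>cos ((2k+1) w) / cos w\<close> as a polynomial in \<open>z = 4 sin^2 w\<close>).
  The coefficient of \<open>z^j\<close> in \<open>W_k\<close>, hence also in the power series \<open>1 / W_k\<close>, is a polynomial of
  degree at most \<open>j\<close> in \<open>k(k+1)\<close>. The coefficient of \<open>z^j\<close> in \<open>x R_2\<close> is therefore an alternating
  sum of \<open>(2m+1 choose m-k)\<close> against a polynomial of degree at most \<open>2(s+j) + 1\<close> in \<open>k\<close>
  that is antisymmetric under \<open>k \<mapsto> -1 - k\<close>, and vanishes when \<open>j < m - s\<close> as a finite difference
  of order \<open>2m + 1\<close>. Integrality of the quotient holds because the weights in \<open>R_2\<close> are integers
  and \<open>x^2 + 4\<close> is monic.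
\<close>

section \<open>Alternating binomial sums against polynomials of low degree\<close>

lemma degree_pcompose_shift_diff_less:
  fixes q :: "'a::idom poly"
  assumes "degree q > 0"
  shows "degree (q \<circ>\<^sub>p [:1, 1:] - q) < degree q"
proof (rule degree_lessI)
  show "q \<circ>\<^sub>p [:1, 1:] - q \<noteq> 0 \<or> 0 < degree q"
    using assms by simp
  have "lead_coeff (q \<circ>\<^sub>p [:1, 1:]) = lead_coeff q"
    by (subst lead_coeff_comp) auto
  moreover have deg: "degree (q \<circ>\<^sub>p [:1, 1:]) = degree q"
    by (simp add: degree_pcompose)
  ultimately show "\<forall>k\<ge>degree q. coeff (q \<circ>\<^sub>p [:1, 1:] - q) k = 0"
    by (metis coeff_diff coeff_eq_0 diff_self le_neq_implies_less)
qed

text \<open>Induction on \<open>N\<close>: Pascal's rule turns the sum of order \<open>N + 1\<close>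
  for \<open>q\<close> into minus the sum of order \<open>N\<close> for the difference q(x + 1) -
  q(x), which has smaller degree, or is zero if \<open>q\<close> is constant.\<close>

lemma alternating_binomial_sum_poly_eq_0:
  fixes q :: "'a::idom poly"
  assumes "degree q < N"
  shows "(\<Sum>i\<le>N. (-1) ^ i * of_nat (N choose i) * poly q (of_nat i)) = 0"
  using assms
proof (induction N arbitrary: q)
  case 0
  then show ?case by simp
next
  case (Suc N)
  define r where "r = q \<circ>\<^sub>p [:1, 1:] - q"
  have r: "poly r x = poly q (1 + x) - poly q x" for x
    by (simp add: r_def poly_pcompose)
  let ?t = "\<lambda>i. (-1) ^ i * of_nat (N choose i) * poly q (of_nat i) :: 'a"
  let ?u = "\<lambda>i. (-1) ^ i * of_nat (N choose i) * poly q (of_nat (Suc i)) :: 'a"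
  have "(-1) ^ Suc i * of_nat (Suc N choose Suc i) * poly q (of_nat (Suc i)) = ?t (Suc i) - ?u i" for i
    by (simp add: algebra_simps)
  then have "(\<Sum>i\<le>Suc N. (-1) ^ i * of_nat (Suc N choose i) * poly q (of_nat i))
      = ?t 0 + (\<Sum>i\<le>N. ?t (Suc i) - ?u i)"
    by (subst sum.atMost_Suc_shift) simp
  also have "\<dots> = (\<Sum>i\<le>Suc N. ?t i) - (\<Sum>i\<le>N. ?u i)"
    by (subst sum.atMost_Suc_shift) (simp add: sum_subtractf)
  also have "(\<Sum>i\<le>Suc N. ?t i) = (\<Sum>i\<le>N. ?t i)"
    by (simp add: binomial_eq_0)
  also have "\<dots> - (\<Sum>i\<le>N. ?u i) = - (\<Sum>i\<le>N. (-1) ^ i * of_nat (N choose i) * poly r (of_nat i))"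
    by (simp add: r sum_subtractf algebra_simps)
  also have "(\<Sum>i\<le>N. (-1) ^ i * of_nat (N choose i) * poly r (of_nat i)) = 0"
  proof (cases "degree q = 0")
    case True
    then obtain c where "q = [:c:]" by (metis degree_eq_zeroE)
    then have "r = 0" by (simp add: r_def)
    then show ?thesis by simp
  next
    case False
    then have "degree r < degree q"
      unfolding r_def by (intro degree_pcompose_shift_diff_less) simp
    then show ?thesis
      using Suc.prems by (intro Suc.IH) simp
  qed
  finally show ?case by simp
qed

text \<open>Reflecting \<open>k \<mapsto> -1 - k\<close> turns this into half of a full alternating sum over \<open>2m + 1\<close>.\<close>

lemma half_alternating_binomial_sum_eq_0:
  fixes g :: "rat poly"
  assumes "degree g < m"
  shows "(\<Sum>k\<le>m. (-1) ^ k * of_nat ((2 * m + 1) choose (m - k)) * of_nat (2 * k + 1)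
            * poly g (of_nat k * (of_nat k + 1))) = 0" (is "?S = 0")
proof -
  define M :: rat where "M = of_nat m"
  \<comment> \<open>At both i = m - k and i = m + 1 + k the argument of \<open>g\<close> is k(k +
    1), while the linear factor is -(2k + 1) and 2k + 1 respectively. The sign (-1)^i makes up for
    this, so both halves of the full sum equal -(-1)^m times \<open>?S\<close>.\<close>
  define f where "f = [:- (2 * M + 1), 2:] * (g \<circ>\<^sub>p ([:- M, 1:] * [:- M - 1, 1:]))"
  have f: "poly f x = (2 * x - (2 * M + 1)) * poly g ((x - M) * (x - M - 1))" for x
    by (simp add: f_def poly_pcompose algebra_simps)
  let ?h = "\<lambda>i. (-1) ^ i * of_nat ((2 * m + 1) choose i) * poly f (of_nat i) :: rat"
  let ?w = "\<lambda>k. (-1) ^ k * of_nat ((2 * m + 1) choose (m - k)) * of_nat (2 * k + 1)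
            * poly g (of_nat k * (of_nat k + 1)) :: rat"
  have "degree f \<le> 1 + degree g * 2"
    unfolding f_def
    by (intro degree_mult_le[THEN order_trans] add_mono degree_pcompose_le[THEN order_trans]) auto
  with assms have "degree f < 2 * m + 1" by simp
  then have "(\<Sum>i\<le>2 * m + 1. ?h i) = 0"
    by (rule alternating_binomial_sum_poly_eq_0)
  moreover have "{..2 * m + 1} = {..m} \<union> {m + 1..2 * m + 1}" by auto
  then have "(\<Sum>i\<le>2 * m + 1. ?h i) = (\<Sum>i\<le>m. ?h i) + (\<Sum>i=m + 1..2 * m + 1. ?h i)"
    by (simp only:) (rule sum.union_disjoint; auto)
  moreover have "(\<Sum>i\<le>m. ?h i) = (\<Sum>k\<le>m. - ((-1) ^ m) * ?w k)"
  proof (rule sum.reindex_bij_witness[of _ "\<lambda>k. m - k" "\<lambda>k. m - k"])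
    fix k assume "k \<in> {..m}"
    then obtain l where l: "m = k + l" by (metis atMost_iff le_iff_add)
    have sign: "(-1) ^ l * ((-1) ^ (k + l) * x) = (-1) ^ k * x" for x :: rat
      by (simp add: power_add mult.left_commute[of "(-1) ^ l"])
    show "- ((-1) ^ m) * ?w (m - k) = ?h k"
      by (simp add: sign f l M_def algebra_simps)
  qed auto
  moreover have "(\<Sum>i=m + 1..2 * m + 1. ?h i) = (\<Sum>k\<le>m. - ((-1) ^ m) * ?w k)"
  proof (rule sum.reindex_bij_witness[of _ "\<lambda>k. m + 1 + k" "\<lambda>i. i - (m + 1)"])
    fix i assume "i \<in> {m + 1..2 * m + 1}"
    then obtain k where k: "i = m + 1 + k" "k \<le> m"
      by (intro that[of "i - (m + 1)"]) auto
    have "(2 * m + 1) choose (m - k) = (2 * m + 1) choose i"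
      using k binomial_symmetric[of i "2 * m + 1"] by simp
    with k show "- ((-1) ^ m) * ?w (i - (m + 1)) = ?h i"
      by (simp add: f M_def power_add algebra_simps)
  qed auto
  ultimately have "- ((-1) ^ m) * ?S + - ((-1) ^ m) * ?S = 0"
    by (simp only: sum_distrib_left)
  then show ?thesis by simp
qed

section \<open>Coefficients as polynomials in k(k + 1)\<close>

text \<open>\<open>(k + j choose 2j)\<close> as a polynomial in \<open>k(k + 1)\<close>, since \<open>(k - i)(k + i + 1) = k(k + 1) - i(i + 1)\<close>.\<close>

definition central_binom_poly :: "nat \<Rightarrow> rat poly" where
  "central_binom_poly j = smult (1 / fact (2 * j)) (\<Prod>i<j. [:- of_nat (i * (i + 1)), 1:])"

lemma degree_central_binom_poly_le: "degree (central_binom_poly j) \<le> j"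
proof -
  have "degree (\<Prod>i<j. [:- of_nat (i * (i + 1)), 1::rat:]) \<le> (\<Sum>i<j. 1)"
    by (rule order_trans[OF degree_prod_sum_le]) auto
  then show ?thesis by (simp add: central_binom_poly_def)
qed

text \<open>Two absorption steps; (k + j + 1)(k - j) is the factor k(k + 1) - j(j + 1) that
  \<open>central_binom_poly\<close> gains from \<open>j\<close> to \<open>Suc j\<close>.\<close>

lemma Suc_binomial_2Suc:
  "(2 * j + 1) * (2 * j + 2) * (k + Suc j choose (2 * Suc j)) = (k + j + 1) * (k - j) * (k + j choose (2 * j))"
proof -
  have "(2 * j + 2) * (k + Suc j choose (2 * Suc j)) = (k + j + 1) * (k + j choose (2 * j + 1))"
    using Suc_times_binomial_eq[of "k + j" "2 * j + 1"] by (simp add: algebra_simps)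
  moreover have "(2 * j + 1) * (k + j choose (2 * j + 1)) = (k - j) * (k + j choose (2 * j))"
    using binomial_absorb_comp[of "k + j" "2 * j"] binomial_absorption[of "2 * j" "k + j"]
    by (simp add: algebra_simps)
  ultimately show ?thesis by (metis mult.assoc mult.left_commute)
qed

lemma poly_central_binom_poly:
  "poly (central_binom_poly j) (of_nat k * (of_nat k + 1)) = of_nat (k + j choose (2 * j))"
proof (induction j)
  case 0
  then show ?case by (simp add: central_binom_poly_def)
next
  case (Suc j)
  let ?K = "of_nat k :: rat" and ?J = "of_nat j :: rat"
  have pos: "(2 * ?J + 1) * (2 * ?J + 2) > 0" by (intro mult_pos_pos) auto
  have "(2 * ?J + 1) * (2 * ?J + 2) * poly (central_binom_poly (Suc j)) (of_nat k * (of_nat k + 1))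
      = (?K - ?J) * (?K + ?J + 1) * poly (central_binom_poly j) (of_nat k * (of_nat k + 1))"
  proof -
    have c: "poly (central_binom_poly i) x = 1 / fact (2 * i) * (\<Prod>l<i. poly [:- of_nat (l * (l + 1)), 1:] x)" for i x
      by (simp only: central_binom_poly_def poly_smult poly_prod)
    have fct: "(fact (2 * Suc j) :: rat) = (2 * ?J + 1) * (2 * ?J + 2) * fact (2 * j)"
      by (simp add: algebra_simps)
    have factor: "poly [:- of_nat (j * (j + 1)), 1:] (of_nat k * (of_nat k + 1)) = (?K - ?J) * (?K + ?J + 1)"
      by (simp add: algebra_simps)
    have cancel: "a * (1 / (a * b) * (p * d)) = d * (1 / b * p)" if "a \<noteq> 0" for a b p d :: rat
      using that by simp
    show ?thesis
      unfolding c prod.lessThan_Suc fct factor using pos by (intro cancel) simp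
  qed
  also have "\<dots> = (?K - ?J) * (?K + ?J + 1) * of_nat (k + j choose (2 * j))"
    using Suc by simp
  also have "\<dots> = of_nat ((k + j + 1) * (k - j) * (k + j choose (2 * j)))"
  \<comment> \<open>For k < j the truncated k - j differs from \<open>?K - ?J\<close>, but the
    binomial coefficient is zero.\<close>
  proof (cases "j \<le> k")
    case True
    then obtain d where "k = j + d" by (metis le_iff_add)
    then show ?thesis by (simp add: algebra_simps)
  qed (simp add: binomial_eq_0)
  also have "\<dots> = (2 * ?J + 1) * (2 * ?J + 2) * of_nat (k + Suc j choose (2 * Suc j))"
    unfolding Suc_binomial_2Suc[symmetric] by (simp add: algebra_simps)
  finally show ?case using pos by simp
qed

text \<open>The coefficients of the reciprocal of \<open>\<Sum>j. (-1)^j (k + j choose 2j) z^j\<close>, as polynomials in \<open>k(k + 1)\<close>.\<close>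

fun recip_coeff_poly :: "nat \<Rightarrow> rat poly" where
  "recip_coeff_poly n = (if n = 0 then 1 else
     - (\<Sum>i<n. smult ((-1) ^ (n - i)) (central_binom_poly (n - i)) * recip_coeff_poly i))"

declare recip_coeff_poly.simps [simp del]

lemma degree_recip_coeff_poly_le: "degree (recip_coeff_poly n) \<le> n"
proof (induction n rule: less_induct)
  case (less n)
  have "degree (smult ((-1) ^ (n - i)) (central_binom_poly (n - i)) * recip_coeff_poly i) \<le> n"
    if "i < n" for i
  proof -
    have "degree (smult ((-1) ^ (n - i)) (central_binom_poly (n - i)) * recip_coeff_poly i)
        \<le> (n - i) + i"
      using less[OF that] degree_central_binom_poly_le[of "n - i"]
      by (intro degree_mult_le[THEN order_trans] add_mono) auto
    then show ?thesis using that by simp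
  qed
  then show ?case
    by (subst recip_coeff_poly.simps) (auto intro!: degree_sum_le)
qed

section \<open>The polynomials W_k and their truncated reciprocals\<close>

definition W :: "nat \<Rightarrow> rat poly" where
  "W k = (\<Sum>j\<le>k. monom ((-1) ^ j * of_nat (k + j choose (2 * j))) j)"

text \<open>The power series 1 / W_k cut off below degree \<open>n\<close>, so that substituting x^2
  + 4 stays within polynomials.\<close>

definition recip_W :: "nat \<Rightarrow> nat \<Rightarrow> rat poly" where
  "recip_W n k = (\<Sum>j<n. monom (poly (recip_coeff_poly j) (of_nat k * (of_nat k + 1))) j)"

lemma coeff_W: "coeff (W k) j = (-1) ^ j * of_nat (k + j choose (2 * j))"
  by (auto simp: W_def coeff_sum coeff_monom sum.delta)

lemma coeff_recip_W:
  "coeff (recip_W n k) j = (if j < n then poly (recip_coeff_poly j) (of_nat k * (of_nat k + 1)) else 0)"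
  by (auto simp: recip_W_def coeff_sum coeff_monom sum.delta)

text \<open>The recursion for \<open>recip_coeff_poly\<close> makes the Cauchy product with the
  coefficients of \<open>W k\<close> equal to 1 in degree 0 and to 0 above; truncation does not
  affect degrees below \<open>n\<close>.\<close>

lemma monom_dvd_W_mult_recip_W: "monom 1 n dvd W k * recip_W n k - 1"
  unfolding monom_1_dvd_iff'
proof safe
  fix j assume j: "j < n"
  let ?y = "of_nat k * (of_nat k + 1) :: rat"
  have "coeff (W k * recip_W n k) j
      = (\<Sum>i\<le>j. coeff (W k) (j - i) * coeff (recip_W n k) i)"
    unfolding mult.commute[of "W k"] coeff_mult by (simp add: mult.commute)
  also have "\<dots> = (\<Sum>i\<le>j. poly (smult ((-1) ^ (j - i)) (central_binom_poly (j - i)) * recip_coeff_poly i) ?y)"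
    using j by (intro sum.cong) (simp_all add: coeff_W coeff_recip_W poly_central_binom_poly del: of_nat_mult)
  also have "\<dots> = (\<Sum>i<j. poly (smult ((-1) ^ (j - i)) (central_binom_poly (j - i)) * recip_coeff_poly i) ?y)
      + poly (recip_coeff_poly j) ?y"
    by (simp add: lessThan_Suc_atMost[symmetric] central_binom_poly_def)
  also have "\<dots> = (if j = 0 then 1 else 0)"
    by (subst (2) recip_coeff_poly.simps) (simp add: poly_sum del: of_nat_mult)
  finally show "coeff (W k * recip_W n k - 1) j = 0"
    by simp
qed

section \<open>Odd-indexed Lucas polynomials in terms of W_k\<close>

text \<open>Pascal's rule on coefficients. In trigonometric form: cos((2k + 5)w) + cos((2k + 1)w) =
  2 cos(2w) cos((2k + 3)w), where 2 cos(2w) = 2 - z.\<close>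

lemma W_Suc_Suc: "W (Suc (Suc k)) = [:2, -1:] * W (Suc k) - W k"
proof (rule poly_eqI)
  fix j
  show "coeff (W (Suc (Suc k))) j = coeff ([:2, -1:] * W (Suc k) - W k) j"
  proof (cases j)
    case 0
    then show ?thesis by (simp add: coeff_W)
  next
    case (Suc i)
    have "(k + i + 3 choose (2 * i + 2)) + (k + i + 1 choose (2 * i + 2))
        = 2 * (k + i + 2 choose (2 * i + 2)) + (k + i + 1 choose (2 * i))"
      by (simp add: numeral_eq_Suc)
    then have "(of_nat (k + i + 3 choose (2 * i + 2)) + of_nat (k + i + 1 choose (2 * i + 2)) :: rat)
        = 2 * of_nat (k + i + 2 choose (2 * i + 2)) + of_nat (k + i + 1 choose (2 * i))"
      by (metis of_nat_add of_nat_mult of_nat_numeral)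
    then show ?thesis
      by (simp add: coeff_W Suc numeral_eq_Suc algebra_simps)
  qed
qed

text \<open>The recurrences match: L_{2k+5} = (x^2 + 2) L_{2k+3} - L_{2k+1}, and 2 - z becomes -(x^2
  + 2) at z = x^2 + 4, which accounts for the sign (-1)^k.\<close>

lemma lucas_poly_odd_eq: "lucas_poly (2 * k + 1) = smult ((-1) ^ k) ([:0, 1:] * (W k \<circ>\<^sub>p [:4, 0, 1:]))"
proof (induction k rule: induct_nat_012)
  case 0
  then show ?case by (simp add: W_def pcompose_1 flip: one_pCons)
next
  case 1
  then show ?case by (simp add: W_def numeral_eq_Suc monom_Suc monom_0 pcompose_pCons)
next
  case (ge2 k)
  define X Y :: "rat poly" where "X = [:0, 1:]" and "Y = [:2, 0, 1:]"
  have "lucas_poly (2 * Suc (Suc k) + 1) = X * lucas_poly (2 * k + 4) + lucas_poly (2 * k + 3)"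
    "lucas_poly (2 * k + 4) = X * lucas_poly (2 * k + 3) + lucas_poly (2 * k + 2)"
    "lucas_poly (2 * k + 3) = X * lucas_poly (2 * k + 2) + lucas_poly (2 * k + 1)"
    by (simp_all add: X_def numeral_eq_Suc)
  moreover have "Y = X * X + 2" "2 * Suc k + 1 = 2 * k + 3"
    by (simp_all add: X_def Y_def numeral_poly)
  ultimately have "lucas_poly (2 * Suc (Suc k) + 1)
      = Y * lucas_poly (2 * Suc k + 1) - lucas_poly (2 * k + 1)"
    by (simp only:) (simp add: algebra_simps del: lucas_poly.simps)
  also have "\<dots> = smult ((-1) ^ Suc (Suc k)) ([:0, 1:] * (W (Suc (Suc k)) \<circ>\<^sub>p [:4, 0, 1:]))"
  proof -
    have "[:2, -1:] \<circ>\<^sub>p [:4, 0, 1:] = - Y"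
      by (simp add: Y_def pcompose_pCons)
    then show ?thesis
      unfolding ge2 W_Suc_Suc pcompose_diff pcompose_mult X_def[symmetric]
      by (simp add: smult_diff_right smult_add_right algebra_simps)
  qed
  finally show ?case .
qed

lemma lucas_poly_nonzero: "lucas_poly n \<noteq> 0"
proof -
  have "poly (lucas_poly n) 1 > 0"
    by (induction n rule: lucas_poly.induct) auto
  then show ?thesis by auto
qed

section \<open>Polynomials with integer coefficients\<close>

definition int_coeffs :: "'a::ring_1 poly \<Rightarrow> bool" where
  "int_coeffs p \<longleftrightarrow> (\<forall>i. coeff p i \<in> \<int>)"

lemma int_coeffs_pCons [simp]: "int_coeffs (pCons a p) \<longleftrightarrow> a \<in> \<int> \<and> int_coeffs p"
  unfolding int_coeffs_def by (metis coeff_pCons_0 coeff_pCons_Suc not0_implies_Suc)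

lemma int_coeffs_0 [simp]: "int_coeffs 0"
  by (simp add: int_coeffs_def)

lemma int_coeffs_1 [simp]: "int_coeffs (1 :: 'a::comm_ring_1 poly)"
  by (simp add: one_pCons)

lemma int_coeffs_add: "int_coeffs p \<Longrightarrow> int_coeffs q \<Longrightarrow> int_coeffs (p + q)"
  by (simp add: int_coeffs_def)

lemma int_coeffs_mult:
  fixes p q :: "'a::comm_ring_1 poly"
  shows "int_coeffs p \<Longrightarrow> int_coeffs q \<Longrightarrow> int_coeffs (p * q)"
  by (auto simp: int_coeffs_def coeff_mult intro!: Ints_sum)

lemma int_coeffs_sum: "(\<And>i. i \<in> A \<Longrightarrow> int_coeffs (f i)) \<Longrightarrow> int_coeffs (sum f A)"
  by (induction A rule: infinite_finite_induct) (auto intro: int_coeffs_add)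

lemma int_coeffs_prod:
  fixes f :: "'b \<Rightarrow> 'a::comm_ring_1 poly"
  shows "(\<And>i. i \<in> A \<Longrightarrow> int_coeffs (f i)) \<Longrightarrow> int_coeffs (prod f A)"
  by (induction A rule: infinite_finite_induct) (auto intro: int_coeffs_mult)

lemma int_coeffs_power:
  fixes p :: "'a::comm_ring_1 poly"
  shows "int_coeffs p \<Longrightarrow> int_coeffs (p ^ n)"
  by (induction n) (auto intro: int_coeffs_mult)

lemma int_coeffs_of_nat [simp]: "int_coeffs (of_nat n :: 'a::comm_ring_1 poly)"
  by (simp add: of_nat_poly)

lemma int_coeffs_lucas_poly: "int_coeffs (lucas_poly n)"
  by (induction n rule: lucas_poly.induct) (auto intro!: int_coeffs_add int_coeffs_mult)

text \<open>Downward induction from the top coefficient of \<open>q\<close>: as \<open>d\<close> is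
  monic, the coefficient of \<open>d * q\<close> at \<open>degree d + i\<close> is that of
  \<open>q\<close> at \<open>i\<close> plus integer multiples of higher coefficients of
  \<open>q\<close>.\<close>

lemma int_coeffs_cancel_monic:
  fixes d q :: "'a::comm_ring_1 poly"
  assumes d: "int_coeffs d" "lead_coeff d = 1" and dq: "int_coeffs (d * q)"
  shows "int_coeffs q"
proof -
  have "coeff q i \<in> \<int>" for i
  proof (induction "Suc (degree q) - i" arbitrary: i rule: less_induct)
    case less
    show ?case
    proof (cases "i \<le> degree q")
      case True
      let ?n = "degree d + i"
      have "coeff (d * q) ?n = (\<Sum>j\<le>?n. coeff d j * coeff q (?n - j))"
        by (rule coeff_mult)
      also have "\<dots> = (\<Sum>j\<le>degree d. coeff d j * coeff q (?n - j))"
        by (rule sum.mono_neutral_right) (auto simp: coeff_eq_0)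
      also have "\<dots> = (\<Sum>j<degree d. coeff d j * coeff q (?n - j)) + coeff q i"
        using d by (simp add: lessThan_Suc_atMost[symmetric])
      finally have "coeff q i = coeff (d * q) ?n - (\<Sum>j<degree d. coeff d j * coeff q (?n - j))"
        by simp
      moreover have "(\<Sum>j<degree d. coeff d j * coeff q (?n - j)) \<in> \<int>"
        using d True by (intro Ints_sum Ints_mult less) (auto simp: int_coeffs_def)
      ultimately show ?thesis
        using dq by (simp add: int_coeffs_def)
    qed (simp add: coeff_eq_0)
  qed
  then show ?thesis by (simp add: int_coeffs_def)
qed

section \<open>Clearing denominators in R\<close>

text \<open>Shows that the weights in \<open>R2\<close> are integers. Absorbing 2s + 1 into the two
  binomials gives the factors k + s + 1 and k - s, whose sum is 2k + 1.\<close>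

lemma odd_ratio_binomial_eq:
  "(2 * s + 1) * ((k + s + 1 choose (2 * s + 1)) + (k + s choose (2 * s + 1)))
     = (2 * k + 1) * (k + s choose (2 * s))"
proof (cases "s \<le> k")
  case True
  have "(2 * s + 1) * (k + s + 1 choose (2 * s + 1)) = (k + s + 1) * (k + s choose (2 * s))"
    using Suc_times_binomial_eq[of "k + s" "2 * s"] by (simp add: algebra_simps)
  moreover have "(2 * s + 1) * (k + s choose (2 * s + 1)) = (k - s) * (k + s choose (2 * s))"
    using binomial_absorb_comp[of "k + s" "2 * s"] binomial_absorption[of "2 * s" "k + s"]
    by (simp add: algebra_simps)
  ultimately have "(2 * s + 1) * ((k + s + 1 choose (2 * s + 1)) + (k + s choose (2 * s + 1)))
      = ((k + s + 1) + (k - s)) * (k + s choose (2 * s))"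
    by (simp add: distrib_left distrib_right)
  then show ?thesis using True by simp
qed (simp add: binomial_eq_0)

definition R_coeff :: "nat \<Rightarrow> nat \<Rightarrow> nat \<Rightarrow> nat" where
  "R_coeff m s k =
     ((k + s + 1 choose (2 * s + 1)) + (k + s choose (2 * s + 1))) * ((2 * m + 1) choose (m - k))"

lemma R_coeff_eq:
  "(2 * s + 1) * R_coeff m s k = (2 * k + 1) * (k + s choose (2 * s)) * ((2 * m + 1) choose (m - k))"
  unfolding R_coeff_def mult.assoc[symmetric] odd_ratio_binomial_eq ..

definition R_numer :: "nat \<Rightarrow> nat \<Rightarrow> rat poly" where
  "R_numer m s = (\<Sum>k=s..m. of_nat (R_coeff m s k) * (\<Prod>j\<in>{s..m} - {k}. lucas_poly (2 * j + 1)))"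

lemma to_fract_of_nat: "to_fract (of_nat n) = (of_nat n :: 'a::idom fract)"
  by (induction n) auto

text \<open>Each reciprocal in \<open>R2\<close> cancels one factor of \<open>R1\<close>.\<close>

lemma R_eq_to_fract: "R m s = to_fract (R_numer m s)"
proof -
  have "to_fract (R1 m s) * (of_nat (1 + 2 * k) / of_nat (1 + 2 * s)
       * of_nat ((2 * m + 1) choose (m - k)) * of_nat ((k + s) choose (2 * s))
       * (1 / to_fract (lucas_poly (2 * k + 1))))
     = to_fract (of_nat (R_coeff m s k) * (\<Prod>j\<in>{s..m} - {k}. lucas_poly (2 * j + 1)))"
    if "k \<in> {s..m}" for k
  proof -
    let ?F = "of_nat :: nat \<Rightarrow> rat poly fract"
    have nz: "?F (1 + 2 * s) \<noteq> 0"
      unfolding to_fract_of_nat[symmetric] by (simp only: to_fract_eq_0_iff of_nat_eq_0_iff)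
    have "?F (1 + 2 * s) * ?F (R_coeff m s k)
        = ?F (1 + 2 * k) * ?F ((2 * m + 1) choose (m - k)) * ?F ((k + s) choose (2 * s))"
      using arg_cong[OF R_coeff_eq[of s m k], of ?F]
      by (simp only: of_nat_mult add.commute[of 1] mult.assoc mult.commute mult.left_commute)
    then have "?F (1 + 2 * k) / ?F (1 + 2 * s) * ?F ((2 * m + 1) choose (m - k))
        * ?F ((k + s) choose (2 * s)) = ?F (R_coeff m s k)"
      using nz by (simp add: divide_simps mult.commute del: of_nat_add of_nat_mult)
    moreover have "to_fract (R1 m s) * (1 / to_fract (lucas_poly (2 * k + 1)))
        = to_fract (\<Prod>j\<in>{s..m} - {k}. lucas_poly (2 * j + 1))"
    proof -
      have "R1 m s = lucas_poly (2 * k + 1) * (\<Prod>j\<in>{s..m} - {k}. lucas_poly (2 * j + 1))"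
        unfolding R1_def using that by (intro prod.remove) auto
      moreover have "to_fract (lucas_poly (2 * k + 1)) \<noteq> 0"
        by (simp only: to_fract_eq_0_iff lucas_poly_nonzero not_False_eq_True)
      ultimately show ?thesis by (simp del: lucas_poly.simps)
    qed
    ultimately show ?thesis
      by (simp only: to_fract_mult to_fract_of_nat mult.left_commute[of "to_fract (R1 m s)"])
  qed
  then show ?thesis
    unfolding R_def R2_def R_numer_def sum_distrib_left to_fract_sum by (intro sum.cong) auto
qed

section \<open>Divisibility by the power of x^2 + 4\<close>

lemma sum_R_coeff_recip_W_eq_0:
  assumes "s < m"
  shows "(\<Sum>k=s..m. smult ((-1) ^ k * of_nat (R_coeff m s k)) (recip_W (m - s) k)) = 0"
proof (rule poly_eqI)
  fix j
  show "coeff (\<Sum>k=s..m. smult ((-1) ^ k * of_nat (R_coeff m s k)) (recip_W (m - s) k)) j = coeff 0 j"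
  proof (cases "j < m - s")
    case True
    \<comment> \<open>Its degree is at most s + j, which is below m because j < m - s.\<close>
    define g where "g = central_binom_poly s * recip_coeff_poly j"
    let ?y = "\<lambda>k. of_nat k * (of_nat k + 1) :: rat"
    let ?w = "\<lambda>k. (-1) ^ k * of_nat ((2 * m + 1) choose (m - k)) * of_nat (2 * k + 1) * poly g (?y k)"
    have "degree g \<le> s + j"
      unfolding g_def using degree_central_binom_poly_le[of s] degree_recip_coeff_poly_le[of j]
      by (intro degree_mult_le[THEN order_trans] add_mono)
    with True have "(\<Sum>k\<le>m. ?w k) = 0"
      by (intro half_alternating_binomial_sum_eq_0) simp
    \<comment> \<open>The terms with k < s vanish with \<open>k + s choose (2 * s)\<close>.\<close>
    moreover have "(\<Sum>k\<le>m. ?w k) = (\<Sum>k=s..m. ?w k)"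
      by (rule sum.mono_neutral_right)
        (auto simp: g_def poly_central_binom_poly binomial_eq_0)
    moreover have "?w k = of_nat (2 * s + 1)
        * coeff (smult ((-1) ^ k * of_nat (R_coeff m s k)) (recip_W (m - s) k)) j" for k
    proof -
      have "?w k = of_nat ((2 * k + 1) * (k + s choose (2 * s)) * ((2 * m + 1) choose (m - k)))
          * ((-1) ^ k * poly (recip_coeff_poly j) (of_nat k * (of_nat k + 1)))"
        by (simp add: g_def poly_central_binom_poly) (simp add: algebra_simps)
      also have "\<dots> = of_nat (2 * s + 1)
          * coeff (smult ((-1) ^ k * of_nat (R_coeff m s k)) (recip_W (m - s) k)) j"
        unfolding R_coeff_eq[symmetric] using True by (simp add: coeff_recip_W algebra_simps)
      finally show ?thesis .
    qed
    ultimately have "of_nat (2 * s + 1)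
        * coeff (\<Sum>k=s..m. smult ((-1) ^ k * of_nat (R_coeff m s k)) (recip_W (m - s) k)) j = 0"
      by (simp only: coeff_sum sum_distrib_left)
    then show ?thesis
      by (simp del: of_nat_add of_nat_mult)
  qed (simp add: coeff_sum coeff_recip_W)
qed

text \<open>Modulo \<open>(x^2 + 4)^n\<close>, \<open>(-1)^k B k\<close> is \<open>x\<close> times an inverse of \<open>lucas_poly (2k + 1)\<close>, so \<open>x\<close> times the
  numerator is congruent to a multiple of a vanishing sum.\<close>

lemma power_dvd_R_numer:
  assumes "s < m"
  shows "[:4, 0, 1:] ^ (m - s) dvd R_numer m s"
proof -
  define X Z :: "rat poly" where "X = [:0, 1:]" and "Z = [:4, 0, 1:]"
  define n where "n = m - s"
  define B where "B = (\<lambda>k. recip_W n k \<circ>\<^sub>p Z)"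
  let ?L = "\<lambda>k. lucas_poly (2 * k + 1)"
  let ?Q = "\<lambda>k. \<Prod>j\<in>{s..m} - {k}. ?L j"
  let ?c = "\<lambda>k. of_nat (R_coeff m s k) :: rat poly"
  have "Z ^ n dvd X * (?c k * ?Q k) - smult ((-1) ^ k * of_nat (R_coeff m s k)) (B k) * R1 m s"
    if "k \<in> {s..m}" for k
  proof -
    have "R1 m s = ?L k * ?Q k"
      unfolding R1_def using that by (intro prod.remove) auto
    moreover have "?L k = smult ((-1) ^ k) (X * (W k \<circ>\<^sub>p Z))"
      by (simp only: lucas_poly_odd_eq X_def Z_def)
    \<comment> \<open>The sign (-1)^k occurs twice, in the weight and in \<open>?L k\<close>, and
      cancels.\<close>
    ultimately have "X * (?c k * ?Q k) - smult ((-1) ^ k * of_nat (R_coeff m s k)) (B k) * R1 m s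
        = - (((W k * recip_W n k - 1) \<circ>\<^sub>p Z) * (X * ?c k * ?Q k))"
      by (simp add: B_def pcompose_diff pcompose_mult of_nat_poly pcompose_1 smult_diff_right algebra_simps
          del: lucas_poly.simps)
    moreover have "Z ^ n dvd (W k * recip_W n k - 1) \<circ>\<^sub>p Z"
    proof -
      obtain r where "W k * recip_W n k - 1 = monom 1 n * r"
        using monom_dvd_W_mult_recip_W by (metis dvdE)
      moreover have "monom 1 n \<circ>\<^sub>p Z = Z ^ n"
        by (induction n) (simp_all add: monom_0 monom_Suc pcompose_1 pcompose_pCons flip: one_pCons)
      ultimately show ?thesis by (simp add: pcompose_mult)
    qed
    ultimately show ?thesis by simp
  qed
  then have "Z ^ n dvd (\<Sum>k=s..m. X * (?c k * ?Q k)
      - smult ((-1) ^ k * of_nat (R_coeff m s k)) (B k) * R1 m s)"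
    by (rule dvd_sum)
  also have "\<dots> = X * R_numer m s
      - ((\<Sum>k=s..m. smult ((-1) ^ k * of_nat (R_coeff m s k)) (recip_W n k)) \<circ>\<^sub>p Z) * R1 m s"
    by (simp add: R_numer_def B_def sum_subtractf sum_distrib_left sum_distrib_right pcompose_sum pcompose_smult)
  also have "\<dots> = X * R_numer m s"
    using sum_R_coeff_recip_W_eq_0[OF assms] by (simp add: n_def)
  finally have "Z ^ n dvd X * R_numer m s" .
  moreover have "coprime Z X"
  proof (rule coprimeI)
    fix c assume "c dvd Z" "c dvd X"
    moreover have "[:4:] = Z - X * X" by (simp add: X_def Z_def)
    ultimately have "c dvd [:4:]" by simp
    then show "is_unit c" by (rule dvd_trans) (simp add: is_unit_const_poly_iff dvd_field_iff)
  qed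
  then have "coprime (Z ^ n) X"
    by simp
  ultimately show ?thesis
    using coprime_dvd_mult_right_iff[of "Z ^ n" X "R_numer m s"] by (simp add: Z_def n_def)
qed

theorem theorem2p2:
  fixes m s :: nat
  assumes "s < m"
  shows "\<exists>P Q :: rat poly.
           R m s = to_fract P \<and>
           [:4, 0, 1:] ^ (m - s) dvd P \<and>
           R m s / to_fract ([:4, 0, 1:] ^ (m - s)) = to_fract Q \<and>
           (\<forall>i. coeff Q i \<in> \<int>)"
proof -
  let ?D = "[:4, 0, 1:] ^ (m - s) :: rat poly"
  obtain Q where Q: "R_numer m s = ?D * Q"
    using power_dvd_R_numer[OF assms] by (rule dvdE)
  have "?D \<noteq> 0" by simp
  then have "to_fract ?D \<noteq> 0" by (simp only: to_fract_eq_0_iff not_False_eq_True)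
  then have "R m s / to_fract ?D = to_fract Q"
    by (simp only: R_eq_to_fract Q to_fract_mult nonzero_mult_div_cancel_left not_False_eq_True)
  moreover have "int_coeffs (R_numer m s)"
    unfolding R_numer_def
    by (intro int_coeffs_sum int_coeffs_mult int_coeffs_prod int_coeffs_of_nat int_coeffs_lucas_poly)
  then have "int_coeffs Q"
    unfolding Q by (rule int_coeffs_cancel_monic[rotated 2])
      (auto intro!: int_coeffs_power simp: lead_coeff_power)
  ultimately show ?thesis
    using R_eq_to_fract power_dvd_R_numer[OF assms] by (auto simp: int_coeffs_def)
qed

end
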